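(* Let $m,n\ge3$, $0\le r_1\le m$, $0\le r_2\le n$, and let $\Sigma=C_m^{(r_1)}\times C_n^{(r_2)}$ be a Cartesian product of signed cycles. The eigenvalues of $\Sigma$ are $$\lambda_{ij}=2\Big(\cos\frac{(2i-[r_1])\pi}{m}+\cos\frac{(2j-[r_2])\pi}{n}\Big),\qquad 1\le i\le m,\ 1\le j\le n.$$ The Laplacian eigenvalues are $$\lambda_{ij}^L=4-2\Big(\cos\frac{(2i-[r_1])\pi}{m}+\cos\frac{(2j-[r_2])\pi}{n}\Big),\qquad 1\le i\le m,\ 1\le j\le n.$$ The Laplacian eigenvalues are positive, except that $\lambda_{mn}^L=0$ when $r_1$ and $r_2$ are both even. The energy and the Laplacian energy of $\Sigma$ are both equal to $$2\sum_{i=1}^m\sum_{j=1}^n\Big|\cos\frac{(2i-[r_1])\pi}{m}+\cos\frac{(2j-[r_2])\pi}{n}\Big|.$$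
   Context: For an integer $r$, $[r]=0$ if $r$ is even and $[r]=1$ if $r$ is odd. A signed graph $\Sigma=(G,\sigma)$ is a finite simple graph $G=(V,E)$ with a function $\sigma:E\to\{+1,-1\}$. The adjacency matrix $A(\Sigma)$ has $(u,v)$ entry $\sigma(uv)$ if $u,v$ are adjacent and $0$ otherwise; its eigenvalues are the eigenvalues of $\Sigma$, and the energy is the sum of their absolute values. The Laplacian matrix is $L(\Sigma)=D(\Sigma)-A(\Sigma)$, $D(\Sigma)$ being the diagonal matrix of vertex degrees; its eigenvalues are the Laplacian eigenvalues. The Laplacian energy is $\sum_j|\lambda_j(L(\Sigma))-\bar d(\Sigma)|$ with $\bar d(\Sigma)=2|E|/|V|$. The Cartesian product of signed graphs $\Sigma_i=(V_i,E_i,\sigma_i)$, $i=1,2$, is the signed graph on $V_1\times V_2$ in which $(u,v)(u',v')$ is an edge iff $v=v'$ and $uu'\in E_1$ (sign $\sigma_1(uu')$), or $u=u'$ and $vv'\in E_2$ (sign $\sigma_2(vv')$). $C_m^{(r)}$ denotes any signed cycle with $m$ vertices having exactly $r$ negative edges. *)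

theory Defs
  imports Complex_Main "HOL-Library.Countable_Set" "HOL-Library.Multiset"
    "Jordan_Normal_Form.Char_Poly"
begin

definition parity_bit :: "int \<Rightarrow> real" where
  "parity_bit r = (if even r then 0 else 1)"

record 'v sgraph =
  verts :: "'v set"
  edges :: "'v set set"
  esign :: "'v set \<Rightarrow> int"

definition signed_graph :: "'v sgraph \<Rightarrow> bool" where
  "signed_graph S \<longleftrightarrow>
     finite (verts S) \<and>
     (\<forall>e\<in>edges S. e \<subseteq> verts S \<and> card e = 2) \<and>
     (\<forall>e\<in>edges S. esign S e = 1 \<or> esign S e = - 1)"

definition vdegree :: "'v sgraph \<Rightarrow> 'v \<Rightarrow> nat" where
  "vdegree S v = card {e \<in> edges S. v \<in> e}"

definition adj_entry :: "'v sgraph \<Rightarrow> 'v \<Rightarrow> 'v \<Rightarrow> real" where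
  "adj_entry S u v = (if {u, v} \<in> edges S then of_int (esign S {u, v}) else 0)"

definition lap_entry :: "'v sgraph \<Rightarrow> 'v \<Rightarrow> 'v \<Rightarrow> real" where
  "lap_entry S u v = (if u = v then real (vdegree S u) else 0) - adj_entry S u v"

text \<open>
  A matrix indexed by a finite set \<open>V\<close> is turned into an ordinary matrix by means of the
  enumeration \<open>from_nat_into V\<close>.  The characteristic polynomial does not depend on the
  enumeration, see \<open>spectrum_enum\<close> below.  Eigenvalues are counted with multiplicity.  Only
  matrices symmetric in their two indices are used, so all complex eigenvalues are real and
  counting the real roots of the characteristic polynomial loses nothing.
\<close>

definition vmat :: "'v set \<Rightarrow> ('v \<Rightarrow> 'v \<Rightarrow> real) \<Rightarrow> real mat" where
  "vmat V M = mat (card V) (card V) (\<lambda>(i, j). M (from_nat_into V i) (from_nat_into V j))"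

definition spectrum_on :: "'v set \<Rightarrow> ('v \<Rightarrow> 'v \<Rightarrow> real) \<Rightarrow> real multiset" where
  "spectrum_on V M = proots (char_poly (vmat V M))"

definition eigenvalues :: "'v sgraph \<Rightarrow> real multiset" where
  "eigenvalues S = spectrum_on (verts S) (adj_entry S)"

definition laplacian_eigenvalues :: "'v sgraph \<Rightarrow> real multiset" where
  "laplacian_eigenvalues S = spectrum_on (verts S) (lap_entry S)"

definition energy :: "'v sgraph \<Rightarrow> real" where
  "energy S = (\<Sum>x\<in>#eigenvalues S. \<bar>x\<bar>)"

definition mean_degree :: "'v sgraph \<Rightarrow> real" where
  "mean_degree S = 2 * real (card (edges S)) / real (card (verts S))"

definition laplacian_energy :: "'v sgraph \<Rightarrow> real" where
  "laplacian_energy S = (\<Sum>x\<in>#laplacian_eigenvalues S. \<bar>x - mean_degree S\<bar>)"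

text \<open>
  An edge of the product has exactly one constant coordinate; its image under the other
  projection is the edge of the factor it comes from.  Hence the case distinction in \<open>esign\<close>.
\<close>

definition cart_prod :: "'a sgraph \<Rightarrow> 'b sgraph \<Rightarrow> ('a \<times> 'b) sgraph" where
  "cart_prod S T = \<lparr>
     verts = verts S \<times> verts T,
     edges = {{(u, v), (u', v)} |u u' v. {u, u'} \<in> edges S \<and> v \<in> verts T}
           \<union> {{(u, v), (u, v')} |u v v'. u \<in> verts S \<and> {v, v'} \<in> edges T},
     esign = (\<lambda>e. if is_singleton (snd ` e) then esign S (fst ` e) else esign T (snd ` e))\<rparr>"

definition negative_edges :: "'v sgraph \<Rightarrow> 'v set set" where
  "negative_edges S = {e \<in> edges S. esign S e = - 1}"

definition signed_cycle :: "nat \<Rightarrow> nat \<Rightarrow> 'v sgraph \<Rightarrow> bool" where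
  "signed_cycle m r S \<longleftrightarrow>
     signed_graph S \<and>
     (\<exists>c. bij_betw c {..<m} (verts S) \<and> edges S = (\<lambda>i. {c i, c (Suc i mod m)}) ` {..<m}) \<and>
     card (negative_edges S) = r"

lemma spectrum_enum:
  assumes fin: "finite V" and e: "bij_betw e {..<card V} V"
  shows "spectrum_on V M =
    proots (char_poly (mat (card V) (card V) (\<lambda>(i, j). M (e i) (e j))))"
proof -
  let ?n = "card V"
  let ?f = "from_nat_into V"
  let ?B = "mat ?n ?n (\<lambda>(i, j). M (e i) (e j))"
  have f: "bij_betw ?f {..<?n} V"
    using bij_betw_from_nat_into_finite[OF fin] by simp
  define P where "P = mat ?n ?n (\<lambda>(i, j). if ?f i = e j then 1 else (0::real))"
  define Q where "Q = mat ?n ?n (\<lambda>(i, j). if e i = ?f j then 1 else (0::real))"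
  define p where "p = (\<lambda>i. inv_into {..<?n} e (?f i))"
  define q where "q = (\<lambda>i. inv_into {..<?n} ?f (e i))"
  have p: "p i < ?n" "e (p i) = ?f i" if "i < ?n" for i
  proof -
    have *: "?f i \<in> e ` {..<?n}"
      using f e that by (auto simp: bij_betw_def)
    show "p i < ?n" using inv_into_into[OF *] by (simp add: p_def)
    show "e (p i) = ?f i" using f_inv_into_f[OF *] by (simp add: p_def)
  qed
  have q: "q i < ?n" "?f (q i) = e i" if "i < ?n" for i
  proof -
    have *: "e i \<in> ?f ` {..<?n}"
      using f e that by (auto simp: bij_betw_def)
    show "q i < ?n" using inv_into_into[OF *] by (simp add: q_def)
    show "?f (q i) = e i" using f_inv_into_f[OF *] by (simp add: q_def)
  qed
  have ei: "e i = e j \<longleftrightarrow> i = j" if "i < ?n" "j < ?n" for i j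
    using e that by (auto simp: bij_betw_def inj_on_def)
  have fi: "?f i = ?f j \<longleftrightarrow> i = j" if "i < ?n" "j < ?n" for i j
    using f that by (auto simp: bij_betw_def inj_on_def)
  have P_eq: "P = mat ?n ?n (\<lambda>(i, j). if j = p i then 1 else 0)"
    unfolding P_def by (rule eq_matI) (auto simp: p(2)[symmetric] ei p(1))
  have P_eq': "P = mat ?n ?n (\<lambda>(i, j). if i = q j then 1 else 0)"
    unfolding P_def by (rule eq_matI) (auto simp: q(2)[symmetric] fi q(1))
  have Q_eq: "Q = mat ?n ?n (\<lambda>(i, j). if j = q i then 1 else 0)"
    unfolding Q_def by (rule eq_matI) (auto simp: q(2)[symmetric] fi q(1))
  have Q_eq': "Q = mat ?n ?n (\<lambda>(i, j). if i = p j then 1 else 0)"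
    unfolding Q_def by (rule eq_matI) (auto simp: p(2)[symmetric] ei p(1))
  have carr: "P \<in> carrier_mat ?n ?n" "Q \<in> carrier_mat ?n ?n" "?B \<in> carrier_mat ?n ?n"
    "vmat V M \<in> carrier_mat ?n ?n"
    by (auto simp: P_def Q_def vmat_def)
  have PX: "P * X = mat ?n ?n (\<lambda>(i, j). X $$ (p i, j))" if X: "X \<in> carrier_mat ?n ?n" for X
  proof (rule eq_matI)
    fix i j assume "i < dim_row (mat ?n ?n (\<lambda>(i, j). X $$ (p i, j)))"
      "j < dim_col (mat ?n ?n (\<lambda>(i, j). X $$ (p i, j)))"
    then have ij: "i < ?n" "j < ?n" by auto
    have "(P * X) $$ (i, j) = (\<Sum>k = 0..<?n. (if k = p i then 1 else 0) * X $$ (k, j))"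
      using ij X by (simp add: P_eq scalar_prod_def)
    also have "\<dots> = (\<Sum>k = 0..<?n. if k = p i then X $$ (k, j) else 0)"
      by (rule sum.cong) auto
    also have "\<dots> = X $$ (p i, j)" using p(1)[OF ij(1)] by simp
    finally show "(P * X) $$ (i, j) = mat ?n ?n (\<lambda>(i, j). X $$ (p i, j)) $$ (i, j)"
      using ij by simp
  qed (use X carr in auto)
  have XQ: "X * Q = mat ?n ?n (\<lambda>(i, j). X $$ (i, p j))" if X: "X \<in> carrier_mat ?n ?n" for X
  proof (rule eq_matI)
    fix i j assume "i < dim_row (mat ?n ?n (\<lambda>(i, j). X $$ (i, p j)))"
      "j < dim_col (mat ?n ?n (\<lambda>(i, j). X $$ (i, p j)))"
    then have ij: "i < ?n" "j < ?n" by auto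
    have "(X * Q) $$ (i, j) = (\<Sum>k = 0..<?n. X $$ (i, k) * (if k = p j then 1 else 0))"
      using ij X by (simp add: Q_eq' scalar_prod_def)
    also have "\<dots> = (\<Sum>k = 0..<?n. if k = p j then X $$ (i, k) else 0)"
      by (rule sum.cong) auto
    also have "\<dots> = X $$ (i, p j)" using p(1)[OF ij(2)] by simp
    finally show "(X * Q) $$ (i, j) = mat ?n ?n (\<lambda>(i, j). X $$ (i, p j)) $$ (i, j)"
      using ij by simp
  qed (use X carr in auto)
  have pq: "p i = p j \<longleftrightarrow> i = j" if "i < ?n" "j < ?n" for i j
    using p that fi by metis
  have PQ: "P * Q = 1\<^sub>m ?n"
    unfolding PX[OF carr(2)] by (rule eq_matI) (auto simp: Q_eq' p pq)
  have QP: "Q * P = 1\<^sub>m ?n"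
    by (rule mat_mult_left_right_inverse[OF carr(1,2) PQ])
  have sim: "vmat V M = P * ?B * Q"
    unfolding PX[OF carr(3)] by (subst XQ) (auto simp: vmat_def p intro!: eq_matI)
  have "similar_mat (vmat V M) ?B"
    unfolding similar_mat_def similar_mat_wit_def Let_def
    using carr PQ QP sim by (intro exI[of _ P] exI[of _ Q]) auto
  from char_poly_similar[OF this] show ?thesis
    by (simp add: spectrum_on_def)
qed

lemma signed_graph_cart_prod:
  assumes S: "signed_graph S" and T: "signed_graph T"
  shows "signed_graph (cart_prod S T)"
proof -
  have S2: "a \<noteq> b \<and> a \<in> verts S \<and> b \<in> verts S \<and> (esign S {a, b} = 1 \<or> esign S {a, b} = - 1)"
    if "{a, b} \<in> edges S" for a b
    using S that by (fastforce simp: signed_graph_def)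
  have T2: "a \<noteq> b \<and> a \<in> verts T \<and> b \<in> verts T \<and> (esign T {a, b} = 1 \<or> esign T {a, b} = - 1)"
    if "{a, b} \<in> edges T" for a b
    using T that by (fastforce simp: signed_graph_def)
  have "finite (verts (cart_prod S T))"
    using S T by (simp add: signed_graph_def cart_prod_def)
  moreover have "e \<subseteq> verts (cart_prod S T) \<and> card e = 2 \<and>
      (esign (cart_prod S T) e = 1 \<or> esign (cart_prod S T) e = - 1)"
    if e: "e \<in> edges (cart_prod S T)" for e
  proof -
    consider u u' v where "e = {(u, v), (u', v)}" "{u, u'} \<in> edges S" "v \<in> verts T"
      | u v v' where "e = {(u, v), (u, v')}" "u \<in> verts S" "{v, v'} \<in> edges T"
      using e by (auto simp: cart_prod_def)
    then show ?thesis
    proof cases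
      case 1
      then show ?thesis using S2[of u u'] by (auto simp: cart_prod_def)
    next
      case 2
      have "v \<noteq> v'" using T2 2 by blast
      then have "\<not> is_singleton {v, v'}" by (auto simp: is_singleton_def)
      then show ?thesis using 2 T2[of v v'] by (auto simp: cart_prod_def)
    qed
  qed
  ultimately show ?thesis
    unfolding signed_graph_def by blast
qed

lemma cart_prod_adj_entry:
  assumes S: "signed_graph S" and T: "signed_graph T"
    and "u \<in> verts S" "u' \<in> verts S" "v \<in> verts T" "v' \<in> verts T"
  shows "adj_entry (cart_prod S T) (u, v) (u', v') =
    (if v = v' then adj_entry S u u' else if u = u' then adj_entry T v v' else 0)"
proof -
  have S2: "a \<noteq> b" if "{a, b} \<in> edges S" for a b
    using S that by (fastforce simp: signed_graph_def)
  have T2: "a \<noteq> b" if "{a, b} \<in> edges T" for a b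
    using T that by (fastforce simp: signed_graph_def)
  have E: "{(u, v), (u', v')} \<in> edges (cart_prod S T) \<longleftrightarrow>
      v = v' \<and> {u, u'} \<in> edges S \<or> u = u' \<and> {v, v'} \<in> edges T"
    using assms by (fastforce simp: cart_prod_def doubleton_eq_iff insert_commute)
  have "is_singleton {v, v'} \<longleftrightarrow> v = v'"
    by (auto simp: is_singleton_def)
  then show ?thesis
    using S2[of u u] T2[of v v] unfolding adj_entry_def E
    by (auto simp: cart_prod_def is_singleton_def)
qed

end

theory Submission
  imports Defs
begin

text \<open>
  Products of eigenfunctions of the factors are eigenfunctions of a Cartesian product, and the
  eigenvalues add.  A signed cycle has an orthogonal basis of eigenfunctions obtained from characters
  by switching.  The product of two cycles is 4-regular, so its Laplacian matrix is \<open>4 I - A\<close> and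
  its mean degree is 4: the Laplacian eigenvalues and the Laplacian energy follow from the adjacency
  spectrum.
\<close>

section \<open>Spectra from orthogonal eigenfunctions\<close>

text \<open>The functions are complex although \<open>M\<close> and \<open>l\<close> are real,
  because the eigenfunctions of a cycle come from characters. Indexing by \<open>I\<close> keeps
  multiplicities, and \<open>card I = card V\<close> turns an orthogonal family into a basis. The
  squared norm \<open>card V\<close> is that of a function of modulus 1.\<close>

definition eigenbasis ::
  "'v set \<Rightarrow> ('v \<Rightarrow> 'v \<Rightarrow> real) \<Rightarrow> 'i set \<Rightarrow> ('i \<Rightarrow> real) \<Rightarrow> ('i \<Rightarrow> 'v \<Rightarrow> complex) \<Rightarrow> bool" where
  "eigenbasis V M I l f \<longleftrightarrow>
     finite V \<and> finite I \<and> card I = card V \<and>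
     (\<forall>i\<in>I. \<forall>v\<in>V. (\<Sum>w\<in>V. of_real (M v w) * f i w) = of_real (l i) * f i v) \<and>
     (\<forall>i\<in>I. \<forall>j\<in>I. (\<Sum>v\<in>V. f i v * cnj (f j v)) = (if i = j then of_nat (card V) else 0))"

text \<open>Taking the eigenfunctions as columns gives a matrix \<open>P\<close> whose inverse is,
  by orthogonality, its conjugate transpose divided by \<open>card V\<close>. Hence the matrix is
  similar over the complex numbers to the diagonal matrix of the values \<open>l\<close>, and its
  characteristic polynomial splits accordingly.\<close>

lemma spectrum_on_eigenbasis:
  assumes "eigenbasis V M I l f"
  shows "spectrum_on V M = image_mset l (mset_set I)"
proof -
  let ?n = "card V"
  let ?e = "from_nat_into V"
  have fin: "finite V" "finite I" and cI: "card I = ?n"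
    and eig: "\<And>i v. i \<in> I \<Longrightarrow> v \<in> V \<Longrightarrow> (\<Sum>w\<in>V. of_real (M v w) * f i w) = of_real (l i) * f i v"
    and orth: "\<And>i j. i \<in> I \<Longrightarrow> j \<in> I \<Longrightarrow>
      (\<Sum>v\<in>V. f i v * cnj (f j v)) = (if i = j then of_nat ?n else 0)"
    using assms by (auto simp: eigenbasis_def)
  have e: "bij_betw ?e {0..<?n} V"
    using bij_betw_from_nat_into_finite[OF fin(1)] by (simp add: atLeast0LessThan)
  obtain h where h: "bij_betw h {0..<?n} I"
    using ex_bij_betw_nat_finite[OF fin(2)] cI by auto
  have eV: "?e k \<in> V" if "k < ?n" for k
    using e that by (auto simp: bij_betw_def)
  have hI: "h k \<in> I" if "k < ?n" for k
    using h that by (auto simp: bij_betw_def)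
  have h_eq: "h j = h k \<longleftrightarrow> j = k" if "j < ?n" "k < ?n" for j k
    using h that by (auto simp: bij_betw_def inj_on_def)
  have reindex: "(\<Sum>k = 0..<?n. F (?e k)) = (\<Sum>v\<in>V. F v)" for F :: "'a \<Rightarrow> complex"
    using sum.reindex_bij_betw[OF e, of F] .
  define A where "A = map_mat complex_of_real (vmat V M)"
  define P where "P = mat ?n ?n (\<lambda>(k, j). f (h j) (?e k))"
  define Q where "Q = mat ?n ?n (\<lambda>(j, k). cnj (f (h j) (?e k)) / of_nat ?n)"
  define D where "D = mat ?n ?n (\<lambda>(j, k). if j = k then complex_of_real (l (h j)) else 0)"
  have carr: "A \<in> carrier_mat ?n ?n" "P \<in> carrier_mat ?n ?n" "Q \<in> carrier_mat ?n ?n"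
    "D \<in> carrier_mat ?n ?n"
    by (auto simp: A_def P_def Q_def D_def vmat_def)
  have QP: "Q * P = 1\<^sub>m ?n"
  proof (rule eq_matI)
    fix i j assume "i < dim_row (1\<^sub>m ?n :: complex mat)" "j < dim_col (1\<^sub>m ?n :: complex mat)"
    then have ij: "i < ?n" "j < ?n" by auto
    have "(Q * P) $$ (i, j) = (\<Sum>k = 0..<?n. cnj (f (h i) (?e k)) / of_nat ?n * f (h j) (?e k))"
      using ij by (simp add: P_def Q_def scalar_prod_def)
    also have "\<dots> = (\<Sum>v\<in>V. f (h j) v * cnj (f (h i) v)) / of_nat ?n"
      unfolding reindex[of "\<lambda>v. cnj (f (h i) v) / of_nat ?n * f (h j) v"]
      by (simp add: sum_divide_distrib mult.commute)
    also have "\<dots> = (if i = j then 1 else 0)"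
      using ij by (subst orth) (auto simp: hI h_eq)
    finally show "(Q * P) $$ (i, j) = 1\<^sub>m ?n $$ (i, j)"
      using ij by simp
  qed (use carr in auto)
  have PQ: "P * Q = 1\<^sub>m ?n"
    by (rule mat_mult_left_right_inverse[OF carr(3,2) QP])
  interpret poly_hom: map_poly_inj_idom_hom complex_of_real ..
  have AP: "A * P = P * D"
  proof (rule eq_matI)
    fix i j assume "i < dim_row (P * D)" "j < dim_col (P * D)"
    then have ij: "i < ?n" "j < ?n" using carr by auto
    have "(A * P) $$ (i, j) = (\<Sum>k = 0..<?n. of_real (M (?e i) (?e k)) * f (h j) (?e k))"
      using ij by (simp add: A_def P_def vmat_def scalar_prod_def)
    also have "\<dots> = of_real (l (h j)) * f (h j) (?e i)"
      unfolding reindex[of "\<lambda>w. of_real (M (?e i) w) * f (h j) w"]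
      using ij by (intro eig hI eV)
    also have "\<dots> = (\<Sum>k = 0..<?n. if k = j then f (h k) (?e i) * of_real (l (h k)) else 0)"
      using ij by simp
    also have "\<dots> = (\<Sum>k = 0..<?n. f (h k) (?e i) * (if k = j then of_real (l (h k)) else 0))"
      by (rule sum.cong) auto
    also have "\<dots> = (P * D) $$ (i, j)"
      using ij by (simp add: P_def D_def scalar_prod_def)
    finally show "(A * P) $$ (i, j) = (P * D) $$ (i, j)" .
  qed (use carr in auto)
  have "P * D * Q = A * (P * Q)"
    unfolding AP[symmetric] by (rule assoc_mult_mat[OF carr(1,2,3)])
  also have "\<dots> = A"
    unfolding PQ by (rule right_mult_one_mat[OF carr(1)])
  finally have "A = P * D * Q"
    by (rule sym)
  then have "similar_mat A D"
    using carr PQ QP by (intro similar_matI[of _ _ P Q ?n]) auto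
  then have "char_poly A = char_poly D"
    by (rule char_poly_similar)
  also have "\<dots> = (\<Prod>a\<leftarrow>diag_mat D. [:- a, 1:])"
    by (rule char_poly_upper_triangular[OF carr(4)]) (auto simp: D_def upper_triangular_def)
  also have "\<dots> = (\<Prod>k = 0..<?n. [:- of_real (l (h k)), 1:])"
  proof -
    have "diag_mat D = map (\<lambda>k. of_real (l (h k))) [0..<?n]"
      by (auto simp: diag_mat_def D_def)
    then show ?thesis
      using prod.distinct_set_conv_list[of "[0..<?n]" "\<lambda>k. [:- complex_of_real (l (h k)), 1:]"]
      by (simp add: comp_def)
  qed
  also have "\<dots> = (\<Prod>i\<in>I. [:- of_real (l i), 1:])"
    by (rule prod.reindex_bij_betw[OF h])
  also have "\<dots> = map_poly of_real (\<Prod>i\<in>I. [:- l i, 1:])"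
    by (simp add: poly_hom.hom_prod)
  \<comment> \<open>Both polynomials have real coefficients, so the complex identity descends to the
    reals, where \<open>proots\<close> is taken.\<close>
  finally have "map_poly complex_of_real (char_poly (vmat V M)) = map_poly of_real (\<Prod>i\<in>I. [:- l i, 1:])"
    by (simp add: A_def of_real_hom.char_poly_hom[where n = ?n] vmat_def)
  then have "char_poly (vmat V M) = (\<Prod>i\<in>I. [:- l i, 1:])"
    by (rule poly_hom.injectivity)
  then have "spectrum_on V M = (\<Sum>i\<in>I. {#l i#})"
    by (simp add: spectrum_on_def proots_prod)
  also have "\<dots> = image_mset l (mset_set I)"
    using fin(2) by (induction I rule: finite_induct) simp_all
  finally show ?thesis .
qed

text \<open>Passing from \<open>M\<close> to \<open>d I - M\<close> keeps every eigenfunction. For a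
  \<open>d\<close>-regular graph with adjacency matrix \<open>M\<close> this matrix is the
  Laplacian.\<close>

lemma eigenbasis_scalar_minus:
  assumes B: "eigenbasis V M I l f"
    and L: "\<And>v w. v \<in> V \<Longrightarrow> w \<in> V \<Longrightarrow> L v w = (if v = w then d else 0) - M v w"
  shows "eigenbasis V L I (\<lambda>i. d - l i) f"
proof -
  have fin: "finite V"
    using B by (simp add: eigenbasis_def)
  have "(\<Sum>w\<in>V. of_real (L v w) * f i w) = of_real (d - l i) * f i v"
    if i: "i \<in> I" and v: "v \<in> V" for i v
  proof -
    have "(\<Sum>w\<in>V. of_real (L v w) * f i w) =
        (\<Sum>w\<in>V. (if v = w then of_real d * f i w else 0) - of_real (M v w) * f i w)"
      by (rule sum.cong) (auto simp: L[OF v] algebra_simps)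
    also have "\<dots> = of_real d * f i v - of_real (l i) * f i v"
      using B i v fin by (simp add: sum_subtractf eigenbasis_def)
    finally show ?thesis
      by (simp add: algebra_simps)
  qed
  then show ?thesis
    using B by (simp add: eigenbasis_def)
qed

text \<open>The adjacency matrix of the product is the Kronecker sum of those of the factors. Inner
  products of product functions factor, so the squared norms multiply to the number of vertices of
  the product.\<close>

lemma eigenbasis_cart_prod:
  assumes S: "signed_graph S" and T: "signed_graph T"
    and f: "eigenbasis (verts S) (adj_entry S) I k f"
    and g: "eigenbasis (verts T) (adj_entry T) J l g"
  shows "eigenbasis (verts (cart_prod S T)) (adj_entry (cart_prod S T)) (I \<times> J)
    (\<lambda>(i, j). k i + l j) (\<lambda>(i, j) (u, v). f i u * g j v)"
proof -
  let ?V = "verts S" and ?W = "verts T"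
  have V: "verts (cart_prod S T) = ?V \<times> ?W"
    by (simp add: cart_prod_def)
  have fin: "finite ?V" "finite ?W"
    using f g by (auto simp: eigenbasis_def)
  \<comment> \<open>Without loops both terms vanish on the diagonal, so the nested case distinction
    for the entries becomes a sum of two terms.\<close>
  have no_loop: "adj_entry S u u = 0" "adj_entry T v v = 0" for u v
    using S T by (force simp: adj_entry_def signed_graph_def)+
  have adj: "adj_entry (cart_prod S T) (u, v) (u', v') =
      (if v' = v then adj_entry S u u' else 0) + (if u' = u then adj_entry T v v' else 0)"
    if "u \<in> ?V" "u' \<in> ?V" "v \<in> ?W" "v' \<in> ?W" for u u' v v'
    by (auto simp: cart_prod_adj_entry[OF S T that] no_loop)
  have eig: "(\<Sum>(u', v')\<in>?V \<times> ?W. of_real (adj_entry (cart_prod S T) (u, v) (u', v')) * (f i u' * g j v'))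
      = of_real (k i + l j) * (f i u * g j v)"
    if ij: "i \<in> I" "j \<in> J" and uv: "u \<in> ?V" "v \<in> ?W" for i j u v
  proof -
    have "(\<Sum>(u', v')\<in>?V \<times> ?W. of_real (adj_entry (cart_prod S T) (u, v) (u', v')) * (f i u' * g j v'))
      = (\<Sum>u'\<in>?V. \<Sum>v'\<in>?W. (if v' = v then of_real (adj_entry S u u') * f i u' * g j v' else 0)
          + (if u' = u then of_real (adj_entry T v v') * g j v' * f i u' else 0))"
      unfolding sum.cartesian_product[symmetric]
      by (intro sum.cong refl) (auto simp: adj uv algebra_simps)
    \<comment> \<open>Each summand carries a Kronecker delta in one coordinate. Swapping the second
      double sum makes that coordinate the inner one there too.\<close>
    also have "\<dots> = (\<Sum>u'\<in>?V. of_real (adj_entry S u u') * f i u') * g j v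
        + (\<Sum>v'\<in>?W. of_real (adj_entry T v v') * g j v') * f i u"
      unfolding sum.distrib by (subst (2) sum.swap) (use fin uv in \<open>simp add: sum_distrib_right\<close>)
    also have "\<dots> = of_real (k i) * f i u * g j v + of_real (l j) * g j v * f i u"
      using f g ij uv by (simp add: eigenbasis_def)
    finally show ?thesis
      by (simp add: algebra_simps)
  qed
  have orth: "(\<Sum>(u, v)\<in>?V \<times> ?W. f i u * g j v * cnj (f i' u * g j' v))
      = (if (i, j) = (i', j') then of_nat (card (?V \<times> ?W)) else 0)"
    if ij: "i \<in> I" "j \<in> J" "i' \<in> I" "j' \<in> J" for i j i' j'
  proof -
    have "(\<Sum>(u, v)\<in>?V \<times> ?W. f i u * g j v * cnj (f i' u * g j' v))
        = (\<Sum>u\<in>?V. f i u * cnj (f i' u)) * (\<Sum>v\<in>?W. g j v * cnj (g j' v))"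
      unfolding sum_product sum.cartesian_product[symmetric]
      by (intro sum.cong refl) (simp add: algebra_simps)
    also have "\<dots> = (if (i, j) = (i', j') then of_nat (card (?V \<times> ?W)) else 0)"
      using f g ij by (simp add: eigenbasis_def card_cartesian_product)
    finally show ?thesis .
  qed
  show ?thesis
    unfolding eigenbasis_def V
    using f g eig orth
    by (auto simp: card_cartesian_product eigenbasis_def case_prod_unfold)
qed

section \<open>Degrees\<close>

lemma vdegree_eq_card_neighbours:
  assumes "signed_graph S"
  shows "vdegree S v = card {w. {v, w} \<in> edges S}"
proof -
  have "bij_betw (\<lambda>w. {v, w}) {w. {v, w} \<in> edges S} {e \<in> edges S. v \<in> e}"
  proof (rule bij_betw_imageI)
    show "inj_on (\<lambda>w. {v, w}) {w. {v, w} \<in> edges S}"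
      by (auto simp: inj_on_def doubleton_eq_iff)
    have "e \<in> (\<lambda>w. {v, w}) ` {w. {v, w} \<in> edges S}" if "e \<in> edges S" "v \<in> e" for e
    proof -
      have "card e = 2"
        using assms that by (auto simp: signed_graph_def)
      then obtain a b where "e = {a, b}"
        by (auto simp: card_2_iff)
      then show ?thesis
        using that by (auto simp: insert_commute)
    qed
    then show "(\<lambda>w. {v, w}) ` {w. {v, w} \<in> edges S} = {e \<in> edges S. v \<in> e}"
      by auto
  qed
  then show ?thesis
    by (simp add: vdegree_def bij_betw_same_card)
qed

lemma finite_edges:
  assumes "signed_graph S"
  shows "finite (edges S)"
  using assms by (auto simp: signed_graph_def intro: finite_subset[of _ "Pow (verts S)"])

text \<open>Handshake lemma: incident pairs of a vertex and an edge are counted in two ways.\<close>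

lemma sum_vdegree:
  assumes "signed_graph S"
  shows "(\<Sum>v\<in>verts S. vdegree S v) = 2 * card (edges S)"
proof -
  have fin: "finite (verts S)" and E: "\<And>e. e \<in> edges S \<Longrightarrow> e \<subseteq> verts S \<and> card e = 2"
    using assms by (auto simp: signed_graph_def)
  have "(\<Sum>v\<in>verts S. vdegree S v) = (\<Sum>v\<in>verts S. \<Sum>e\<in>edges S. of_bool (v \<in> e))"
    using finite_edges[OF assms] by (simp add: vdegree_def Collect_conj_eq Int_commute)
  also have "\<dots> = (\<Sum>e\<in>edges S. \<Sum>v\<in>verts S. of_bool (v \<in> e))"
    by (rule sum.swap)
  also have "\<dots> = (\<Sum>e\<in>edges S. 2)"
  proof (rule sum.cong)
    fix e assume "e \<in> edges S"
    then have "verts S \<inter> e = e" "card e = 2"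
      using E by auto
    then show "(\<Sum>v\<in>verts S. of_bool (v \<in> e)) = (2::nat)"
      using fin by (simp add: Int_commute)
  qed simp
  finally show ?thesis
    by simp
qed

lemma mean_degree_regular:
  assumes S: "signed_graph S" "verts S \<noteq> {}"
    and d: "\<And>v. v \<in> verts S \<Longrightarrow> vdegree S v = d"
  shows "mean_degree S = real d"
proof -
  have "finite (verts S)"
    using S by (simp add: signed_graph_def)
  then have "card (verts S) > 0"
    using S by (simp add: card_gt_0_iff)
  moreover have "2 * card (edges S) = card (verts S) * d"
    using sum_vdegree[OF S(1)] d by simp
  then have "2 * real (card (edges S)) = real (card (verts S)) * real d"
    by (metis of_nat_mult of_nat_numeral)
  ultimately show ?thesis
    by (simp add: mean_degree_def)
qed

text \<open>The neighbours of a vertex split into those reached by moving in the first coordinate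
  and those reached by moving in the second.\<close>

lemma vdegree_cart_prod:
  assumes S: "signed_graph S" and T: "signed_graph T"
    and uv: "u \<in> verts S" "v \<in> verts T"
  shows "vdegree (cart_prod S T) (u, v) = vdegree S u + vdegree T v"
proof -
  have nS: "{u. {a, u} \<in> edges S} \<subseteq> verts S" and nT: "{v. {b, v} \<in> edges T} \<subseteq> verts T" for a b
    using S T by (auto simp: signed_graph_def)
  have loop: "{u} \<notin> edges S" "{v} \<notin> edges T"
    using S T by (force simp: signed_graph_def)+
  have fin: "finite {u'. {u, u'} \<in> edges S}" "finite {v'. {v, v'} \<in> edges T}"
    using finite_subset[OF nS] finite_subset[OF nT] S T by (auto simp: signed_graph_def)
  have "{w. {(u, v), w} \<in> edges (cart_prod S T)}
      = (\<lambda>u'. (u', v)) ` {u'. {u, u'} \<in> edges S} \<union> (\<lambda>v'. (u, v')) ` {v'. {v, v'} \<in> edges T}"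
    using uv by (fastforce simp: cart_prod_def doubleton_eq_iff insert_commute)
  \<comment> \<open>A common element could only be \<open>(u, v)\<close> itself, which would require
    loops in the factors.\<close>
  moreover have "(\<lambda>u'. (u', v)) ` {u'. {u, u'} \<in> edges S} \<inter> (\<lambda>v'. (u, v')) ` {v'. {v, v'} \<in> edges T} = {}"
    using loop by auto
  ultimately show ?thesis
    using fin by (simp add: vdegree_eq_card_neighbours S T signed_graph_cart_prod
        card_Un_disjoint card_image inj_on_def)
qed

section \<open>Signed cycles\<close>

lemma mod_Suc_cancel: "Suc j mod m = Suc k mod m \<longleftrightarrow> j mod m = k mod m"
  by (auto simp: mod_Suc split: if_splits)

text \<open>This is how \<open>3 \<le> m\<close> enters: the two neighbours of a vertex on the cycle
  are different.\<close>

lemma mod_add_2_neq: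
  assumes "3 \<le> m"
  shows "k mod m \<noteq> Suc (Suc k) mod m"
  using assms by (auto simp: mod_Suc split: if_splits)

text \<open>The walk \<open>g\<close> runs around the cycle forever, so consecutive vertices are
  \<open>g k\<close> and \<open>g (Suc k)\<close> with no reduction of indices. One round traverses
  every edge once, hence its sign product depends only on the number of negative edges.\<close>

lemma signed_cycle_walk:
  assumes C: "signed_cycle m r S" and m: "3 \<le> m"
  obtains g :: "nat \<Rightarrow> 'v" where
    "\<And>j k. g j = g k \<longleftrightarrow> j mod m = k mod m"
    "g ` {..<m} = verts S"
    "edges S = range (\<lambda>k. {g k, g (Suc k)})"
    "(\<Prod>k<m. esign S {g k, g (Suc k)}) = (- 1) ^ r"
proof -
  obtain c where c: "bij_betw c {..<m} (verts S)"
    and E: "edges S = (\<lambda>i. {c i, c (Suc i mod m)}) ` {..<m}"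
    and sg: "signed_graph S" and r: "card (negative_edges S) = r"
    using C unfolding signed_cycle_def by blast
  define g where "g = (\<lambda>k. c (k mod m))"
  have inj: "g j = g k \<longleftrightarrow> j mod m = k mod m" for j k
    using c m by (auto simp: g_def bij_betw_def inj_on_def)
  have im: "g ` {..<m} = verts S"
    using c by (auto simp: g_def bij_betw_def)
  have E': "edges S = (\<lambda>k. {g k, g (Suc k)}) ` {..<m}"
    unfolding E g_def by (rule image_cong) auto
  have "{g k, g (Suc k)} \<in> edges S" for k
  proof -
    have "{g k, g (Suc k)} = {g (k mod m), g (Suc (k mod m))}"
      by (simp add: g_def mod_Suc_eq)
    then show ?thesis
      using m by (auto simp: E')
  qed
  then have range: "edges S = range (\<lambda>k. {g k, g (Suc k)})"
    using E' by auto
  \<comment> \<open>If two different steps used the same edge, they would traverse it in opposite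
    directions, and then \<open>k\<close> and \<open>k + 2\<close> would agree modulo
    \<open>m\<close>.\<close>
  have "inj_on (\<lambda>k. {g k, g (Suc k)}) {..<m}"
  proof (rule inj_onI)
    fix j k assume jk: "j \<in> {..<m}" "k \<in> {..<m}" and eq: "{g j, g (Suc j)} = {g k, g (Suc k)}"
    show "j = k"
    proof (rule ccontr)
      assume "j \<noteq> k"
      then have "j mod m = Suc k mod m" "Suc j mod m = k mod m"
        using eq jk by (auto simp: doubleton_eq_iff inj)
      then show False
        using mod_add_2_neq[OF m, of k] mod_Suc_cancel[of j m "Suc k"] by simp
    qed
  qed
  then have "(\<Prod>k<m. esign S {g k, g (Suc k)}) = (\<Prod>e\<in>edges S. esign S e)"
    unfolding E' by (simp add: prod.reindex)
  also have "\<dots> = (\<Prod>e\<in>edges S. if esign S e = - 1 then - 1 else 1)"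
    using sg by (intro prod.cong) (auto simp: signed_graph_def)
  also have "\<dots> = (- 1) ^ r"
    using r finite_edges[OF sg]
    by (simp add: prod.If_cases negative_edges_def Collect_conj_eq)
  finally show thesis
    using that inj im range by blast
qed

lemma signed_cycle_neighbours:
  assumes inj: "\<And>j k. g j = g k \<longleftrightarrow> j mod m = k mod m"
    and E: "edges S = range (\<lambda>k. {g k, g (Suc k)})"
  shows "{w. {g (Suc k), w} \<in> edges S} = {g k, g (Suc (Suc k))}"
proof (intro equalityI subsetI)
  fix w assume "w \<in> {w. {g (Suc k), w} \<in> edges S}"
  then obtain j where "{g (Suc k), w} = {g j, g (Suc j)}"
    by (auto simp: E)
  then consider "g (Suc k) = g j" "w = g (Suc j)" | "g (Suc k) = g (Suc j)" "w = g j"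
    by (auto simp: doubleton_eq_iff)
  then show "w \<in> {g k, g (Suc (Suc k))}"
    by cases (auto simp: inj mod_Suc_cancel mod_Suc_cancel[of _ _ "Suc k"])
qed (auto simp: E insert_commute)

text \<open>Writing a vertex as a successor lets its neighbours be named \<open>g k\<close> and
  \<open>g (Suc (Suc k))\<close> without subtraction.\<close>

lemma signed_cycle_vertex:
  assumes inj: "\<And>j k. g j = g k \<longleftrightarrow> j mod m = k mod m"
    and im: "g ` {..<m} = V" and v: "v \<in> V" and m: "0 < m"
  obtains k where "v = g (Suc k)"
proof -
  obtain j where "v = g j"
    using im v by auto
  \<comment> \<open>One extra round is added first, so that stepping back is not truncated at
    \<open>j = 0\<close>.\<close>
  moreover have "g j = g (Suc (j + m - 1))"
    using m by (simp add: inj)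
  ultimately show thesis
    using that by blast
qed

lemma signed_cycle_vdegree:
  assumes C: "signed_cycle m r S" and m: "3 \<le> m" and v: "v \<in> verts S"
  shows "vdegree S v = 2"
proof -
  obtain g where g: "\<And>j k. g j = g k \<longleftrightarrow> j mod m = k mod m" "g ` {..<m} = verts S"
    "edges S = range (\<lambda>k. {g k, g (Suc k)})"
    by (rule signed_cycle_walk[OF C m]) blast
  obtain k where "v = g (Suc k)"
    by (rule signed_cycle_vertex[OF g(1,2) v]) (use m in auto)
  moreover have "g k \<noteq> g (Suc (Suc k))"
    using mod_add_2_neq[OF m] by (simp add: g(1))
  ultimately show ?thesis
    using C by (simp add: vdegree_eq_card_neighbours signed_cycle_def
        signed_cycle_neighbours[OF g(1,3)])
qed

section \<open>The complex \<open>m\<close>-th roots of \<open>(- 1) ^ r\<close> and the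
  eigenfunctions of a signed cycle\<close>

definition cycle_angle :: "nat \<Rightarrow> nat \<Rightarrow> nat \<Rightarrow> real" where
  "cycle_angle m r i = (2 * real i - parity_bit r) * pi / real m"

lemma cis_cycle_angle_power:
  assumes "0 < m"
  shows "cis (cycle_angle m r i) ^ m = (- 1) ^ r"
proof -
  have "cis (cycle_angle m r i) ^ m = cis ((2 * real i - parity_bit r) * pi)"
    using assms by (simp add: DeMoivre cycle_angle_def)
  also have "\<dots> = cis (2 * pi * real i) / cis (parity_bit r * pi)"
    by (simp add: cis_divide algebra_simps)
  also have "\<dots> = (- 1) ^ r"
    by (auto simp: parity_bit_def cis_multiple_2pi)
  finally show ?thesis .
qed

text \<open>Equal values force the angles to differ by a multiple of \<open>2 * pi\<close>, so
  \<open>m\<close> divides \<open>i - j\<close>, while \<open>i\<close> and \<open>j\<close> differ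
  by less than \<open>m\<close>. Thus the \<open>m\<close> angles give \<open>m\<close> distinct
  roots of \<open>(- 1) ^ r\<close>, which makes the eigenfunctions orthogonal.\<close>

lemma cis_cycle_angle_inj:
  assumes "i \<in> {1..m}" "j \<in> {1..m}" "cis (cycle_angle m r i) = cis (cycle_angle m r j)"
  shows "i = j"
proof -
  have m: "m > 0"
    using assms by auto
  have "cis (cycle_angle m r i - cycle_angle m r j) = 1"
    using assms(3) by (simp flip: cis_divide)
  then have "cos (cycle_angle m r i - cycle_angle m r j) = 1"
    by (simp add: complex_eq_iff)
  then obtain k :: int where "cycle_angle m r i - cycle_angle m r j = k * 2 * pi"
    by (auto simp: cos_one_2pi_int)
  then have "real i * pi - real j * pi = k * real m * pi"
    using m by (simp add: cycle_angle_def field_simps)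
  then have "(real i - real j) * pi = (k * real m) * pi"
    by (simp add: algebra_simps)
  then have "real i - real j = k * real m"
    by simp
  then have "real_of_int (int i - int j) = real_of_int (k * int m)"
    by simp
  then have "int i - int j = k * int m"
    by (simp only: of_int_eq_iff)
  moreover have "\<bar>int i - int j\<bar> < int m"
    using assms by auto
  ultimately have "\<bar>k\<bar> * int m < 1 * int m"
    by (simp add: abs_mult)
  then have "k = 0"
    by (subst (asm) mult_less_cancel_right) auto
  then show ?thesis
    using \<open>int i - int j = k * int m\<close> by simp
qed

text \<open>
  With \<open>s\<^sub>k\<close> the product of the signs along the first \<open>k\<close> edges and \<open>\<omega>\<^sup>m = (- 1)\<^sup>r\<close>, the
  function \<open>k \<mapsto> s\<^sub>k \<omega>\<^sup>k\<close> is \<open>m\<close>-periodic: the sign picked up around the cycle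
  cancels against \<open>\<omega>\<^sup>m\<close>.
\<close>

lemma signed_cycle_eigenbasis:
  assumes C: "signed_cycle m r S" and m: "3 \<le> m"
  obtains f where "eigenbasis (verts S) (adj_entry S) {1..m} (\<lambda>i. 2 * cos (cycle_angle m r i)) f"
proof -
  obtain g where inj: "\<And>j k. g j = g k \<longleftrightarrow> j mod m = k mod m" and im: "g ` {..<m} = verts S"
    and E: "edges S = range (\<lambda>k. {g k, g (Suc k)})"
    and prod: "(\<Prod>k<m. esign S {g k, g (Suc k)}) = (- 1) ^ r"
    by (rule signed_cycle_walk[OF C m]) blast
  have sg: "signed_graph S"
    using C by (simp add: signed_cycle_def)
  then have fin: "finite (verts S)"
    by (simp add: signed_graph_def)
  define \<sigma> where "\<sigma> k = esign S {g k, g (Suc k)}" for k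
  define s where "s k = (\<Prod>j<k. \<sigma> j)" for k
  define x where "x i k = of_int (s k) * cis (cycle_angle m r i) ^ k" for i k
  \<comment> \<open>The sequence is carried to the vertices through the representative index below
    \<open>m\<close>. Periodicity then allows any index of the vertex, as stated in
    \<open>f_g\<close>.\<close>
  define f where "f i v = x i (inv_into {..<m} g v)" for i v
  have \<sigma>: "\<sigma> k * \<sigma> k = 1" for k
  proof -
    have "{g k, g (Suc k)} \<in> edges S"
      by (auto simp: E)
    then show ?thesis
      using sg by (auto simp: signed_graph_def \<sigma>_def)
  qed
  have s: "s k * s k = 1" for k
  proof (induction k)
    case (Suc k)
    have "s (Suc k) * s (Suc k) = (s k * s k) * (\<sigma> k * \<sigma> k)"
      by (simp add: s_def mult_ac)
    then show ?case
      using Suc by (simp add: \<sigma>)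
  qed (simp add: s_def)
  have s_period: "s (k + m) = (- 1) ^ r * s k" for k
  proof (induction k)
    case 0
    then show ?case
      using prod by (simp add: s_def \<sigma>_def)
  next
    case (Suc k)
    have "g (k + m) = g k" "g (Suc (k + m)) = g (Suc k)"
      by (simp_all add: inj mod_Suc_cancel)
    then show ?case
      using Suc by (simp add: s_def \<sigma>_def)
  qed
  have x_period: "x i (k + m) = x i k" for i k
  proof -
    have "((- 1) ^ r * (- 1) ^ r :: complex) = 1"
      by (simp flip: power_mult_distrib)
    then show ?thesis
      using m by (simp add: x_def s_period power_add cis_cycle_angle_power mult_ac)
  qed
  have x_mod: "x i (k mod m) = x i k" for i k
  proof -
    have "x i (a + b * m) = x i a" for a b
      by (induction b) (use x_period in \<open>simp_all add: add.assoc[symmetric] add.commute[of m]\<close>)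
    from this[of "k mod m" "k div m"] show ?thesis
      by simp
  qed
  have inj_g: "inj_on g {..<m}"
    by (auto simp: inj_on_def inj)
  have f_g: "f i (g k) = x i k" for i k
  proof -
    have "g k = g (k mod m)"
      by (simp add: inj)
    then show ?thesis
      using m by (simp add: f_def inv_into_f_f[OF inj_g] x_mod)
  qed
  \<comment> \<open>Since \<open>s (Suc k) = \<sigma> k * s k\<close> and signs square to 1, the
    edge sign is absorbed by the switching signs. Going one step forward or backward then multiplies
    by the root or its conjugate, as on an unsigned cycle.\<close>
  have step: "of_int (\<sigma> k) * x i k = cis (- cycle_angle m r i) * x i (Suc k)"
    "of_int (\<sigma> k) * x i (Suc k) = cis (cycle_angle m r i) * x i k" for i k
  proof -
    have s_Suc: "s (Suc k) = \<sigma> k * s k"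
      by (simp add: s_def mult.commute)
    have "\<sigma> k * s (Suc k) = \<sigma> k * \<sigma> k * s k"
      unfolding s_Suc by (rule mult.assoc[symmetric])
    then have s_k: "\<sigma> k * s (Suc k) = s k"
      by (simp add: \<sigma>)
    have "of_int (\<sigma> k) * x i (Suc k) = of_int (\<sigma> k * s (Suc k)) * cis (cycle_angle m r i) ^ Suc k"
      by (simp only: x_def of_int_mult mult.assoc)
    then show "of_int (\<sigma> k) * x i (Suc k) = cis (cycle_angle m r i) * x i k"
      by (simp add: s_k x_def)
    have "cis (- cycle_angle m r i) * x i (Suc k)
        = cis (- cycle_angle m r i) * cis (cycle_angle m r i) * (of_int (s (Suc k)) * cis (cycle_angle m r i) ^ k)"
      by (simp add: x_def)
    also have "\<dots> = of_int (s (Suc k)) * cis (cycle_angle m r i) ^ k"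
      by (simp add: cis_mult)
    finally show "of_int (\<sigma> k) * x i k = cis (- cycle_angle m r i) * x i (Suc k)"
      by (simp add: x_def s_Suc)
  qed
  have eig: "(\<Sum>w\<in>verts S. of_real (adj_entry S v w) * f i w) =
      of_real (2 * cos (cycle_angle m r i)) * f i v" if v: "v \<in> verts S" for i v
  proof -
    obtain k where k: "v = g (Suc k)"
      by (rule signed_cycle_vertex[OF inj im v]) (use m in auto)
    have nbr: "{v, w} \<in> edges S \<longleftrightarrow> w \<in> {g k, g (Suc (Suc k))}" for w
      using signed_cycle_neighbours[OF inj E, of k] by (auto simp: k)
    have "(\<Sum>w\<in>verts S. of_real (adj_entry S v w) * f i w)
        = (\<Sum>w\<in>{g k, g (Suc (Suc k))}. of_int (esign S {v, w}) * f i w)"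
    proof (rule sum.mono_neutral_cong_right[OF fin])
      show "{g k, g (Suc (Suc k))} \<subseteq> verts S"
        using sg nbr by (fastforce simp: signed_graph_def)
    qed (auto simp: adj_entry_def nbr)
    \<comment> \<open>The two neighbours are distinct, so the sum over the set has exactly two
      terms.\<close>
    also have "\<dots> = of_int (\<sigma> k) * x i k + of_int (\<sigma> (Suc k)) * x i (Suc (Suc k))"
      using mod_add_2_neq[OF m, of k]
      by (simp add: inj f_g \<sigma>_def k insert_commute)
    also have "\<dots> = (cis (cycle_angle m r i) + cis (- cycle_angle m r i)) * x i (Suc k)"
      by (simp add: step algebra_simps)
    also have "cis (cycle_angle m r i) + cis (- cycle_angle m r i) = of_real (2 * cos (cycle_angle m r i))"
      by (simp add: complex_eq_iff)
    finally show ?thesis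
      by (simp add: k f_g)
  qed
  have card_V: "card (verts S) = m"
    using card_image[OF inj_g] im by simp
  have orth: "(\<Sum>v\<in>verts S. f i v * cnj (f j v)) = (if i = j then of_nat m else 0)"
    if ij: "i \<in> {1..m}" "j \<in> {1..m}" for i j
  proof -
    \<comment> \<open>In the inner product the switching signs occur squared and disappear. What
      remains is a geometric sum in the quotient \<open>z\<close> of two roots of
      \<open>(- 1) ^ r\<close>, and \<open>z ^ m = 1\<close>.\<close>
    define z where "z = cis (cycle_angle m r i) / cis (cycle_angle m r j)"
    have "z ^ m = 1"
      using m by (simp add: z_def power_divide cis_cycle_angle_power)
    have "(\<Sum>v\<in>verts S. f i v * cnj (f j v)) = (\<Sum>k<m. x i k * cnj (x j k))"
      unfolding im[symmetric] by (simp add: sum.reindex[OF inj_g] f_g)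
    also have "\<dots> = (\<Sum>k<m. z ^ k)"
    proof (rule sum.cong)
      fix k
      have "of_int (s k) * of_int (s k) = (1 :: complex)"
        by (metis s of_int_mult of_int_1)
      moreover have "cis (cycle_angle m r i) * cnj (cis (cycle_angle m r j)) = z"
        by (simp add: z_def cis_cnj cis_mult cis_divide)
      moreover have "x i k * cnj (x j k) = (of_int (s k) * of_int (s k))
          * (cis (cycle_angle m r i) * cnj (cis (cycle_angle m r j))) ^ k"
        by (simp add: x_def power_mult_distrib mult_ac)
      ultimately show "x i k * cnj (x j k) = z ^ k"
        by simp
    qed simp
    also have "\<dots> = (if i = j then of_nat m else 0)"
    proof (cases "i = j")
      case False
      \<comment> \<open>Distinct roots give \<open>z \<noteq> 1\<close>, so the geometric sum is
        \<open>(z ^ m - 1) / (z - 1) = 0\<close>.\<close>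
      then have "z \<noteq> 1"
        using cis_cycle_angle_inj[OF ij] by (auto simp: z_def)
      then show ?thesis
        using False \<open>z ^ m = 1\<close> by (simp add: geometric_sum)
    qed (simp add: z_def)
    finally show ?thesis .
  qed
  show thesis
    by (rule that[of f]) (simp add: eigenbasis_def fin card_V eig orth)
qed

section \<open>Positivity of the Laplacian eigenvalues, and the two energies\<close>

lemma cos_cycle_angle_less_1:
  assumes i: "i \<in> {1..m}" and "\<not> (i = m \<and> even r)"
  shows "cos (cycle_angle m r i) < 1"
proof -
  define a where "a = 2 * real i - parity_bit r"
  \<comment> \<open>The value \<open>2 * real m\<close> would be reached only for
    \<open>i = m\<close> and even \<open>r\<close>, the excluded case.\<close>
  have a: "0 < a" "a < 2 * real m"
    using assms by (auto simp: a_def parity_bit_def)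
  then have "0 < a * pi / real m / 2" "a * pi / real m / 2 < pi"
    using i by (auto simp: field_simps)
  then have "0 < sin (a * pi / real m / 2)"
    by (rule sin_gt_zero)
  then have "0 < (sin (a * pi / real m / 2))\<^sup>2"
    by simp
  \<comment> \<open>The half angle lies strictly between 0 and \<open>pi\<close>, where the sine is
    positive, so the double-angle formula keeps the cosine below 1.\<close>
  moreover have "cos (a * pi / real m) = 1 - 2 * (sin (a * pi / real m / 2))\<^sup>2"
    using cos_double_sin[of "a * pi / real m / 2"] by simp
  ultimately show ?thesis
    by (simp add: cycle_angle_def a_def)
qed

lemma cos_cycle_angle_eq_1:
  assumes "0 < m" "even r"
  shows "cos (cycle_angle m r m) = 1"
  using assms by (simp add: cycle_angle_def parity_bit_def)

theorem corollary4p8: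
  fixes m n r1 r2 :: nat
    and C1 :: "'a sgraph" and C2 :: "'b sgraph"
  assumes "m \<ge> 3" and "n \<ge> 3"
    and "0 \<le> r1" and "r1 \<le> m" and "0 \<le> r2" and "r2 \<le> n"
    and "signed_cycle m r1 C1" and "signed_cycle n r2 C2"
  shows "let S = cart_prod C1 C2;
             c = (\<lambda>i j. cos ((2 * real i - parity_bit r1) * pi / real m)
                      + cos ((2 * real j - parity_bit r2) * pi / real n));
             ev = (\<lambda>i j. 2 * c i j);
             evL = (\<lambda>i j. 4 - 2 * c i j)
         in eigenvalues S = {#ev i j. (i, j) \<in># mset_set ({1..m} \<times> {1..n})#}
          \<and> laplacian_eigenvalues S = {#evL i j. (i, j) \<in># mset_set ({1..m} \<times> {1..n})#}
          \<and> (\<forall>i\<in>{1..m}. \<forall>j\<in>{1..n}.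
               if i = m \<and> j = n \<and> even r1 \<and> even r2 then evL i j = 0 else evL i j > 0)
          \<and> energy S = 2 * (\<Sum>i=1..m. \<Sum>j=1..n. \<bar>c i j\<bar>)
          \<and> laplacian_energy S = 2 * (\<Sum>i=1..m. \<Sum>j=1..n. \<bar>c i j\<bar>)"
proof -
  define S where "S = cart_prod C1 C2"
  define c where "c = (\<lambda>i j. cos (cycle_angle m r1 i) + cos (cycle_angle n r2 j))"
  let ?I = "{1..m} \<times> {1..n}"
  have sg: "signed_graph C1" "signed_graph C2"
    using assms by (auto simp: signed_cycle_def)
  then have sgS: "signed_graph S"
    by (simp add: S_def signed_graph_cart_prod)
  obtain f g where
    f: "eigenbasis (verts C1) (adj_entry C1) {1..m} (\<lambda>i. 2 * cos (cycle_angle m r1 i)) f" and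
    g: "eigenbasis (verts C2) (adj_entry C2) {1..n} (\<lambda>j. 2 * cos (cycle_angle n r2 j)) g"
    using signed_cycle_eigenbasis assms by metis
  have eq: "(\<lambda>(i, j). 2 * cos (cycle_angle m r1 i) + 2 * cos (cycle_angle n r2 j)) = (\<lambda>(i, j). 2 * c i j)"
    by (auto simp: c_def)
  obtain h where h: "eigenbasis (verts S) (adj_entry S) ?I (\<lambda>(i, j). 2 * c i j) h"
    using eigenbasis_cart_prod[OF sg f g] unfolding S_def eq by blast
  have deg: "vdegree S w = 4" if "w \<in> verts S" for w
  proof -
    obtain u v where "w = (u, v)" "u \<in> verts C1" "v \<in> verts C2"
      using \<open>w \<in> verts S\<close> by (auto simp: S_def cart_prod_def)
    then show ?thesis
      by (simp add: S_def vdegree_cart_prod[OF sg] signed_cycle_vdegree[OF assms(7,1)]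
          signed_cycle_vdegree[OF assms(8,2)])
  qed
  \<comment> \<open>The mean degree divides by the number of vertices, which equals the size
    \<open>m * n\<close> of the index set of the eigenbasis.\<close>
  have "verts S \<noteq> {}"
    using h assms by (auto simp: eigenbasis_def card_cartesian_product)
  then have mean: "mean_degree S = 4"
    using mean_degree_regular[OF sgS _ deg] by simp
  have ev: "eigenvalues S = {#2 * c i j. (i, j) \<in># mset_set ?I#}"
    unfolding eigenvalues_def by (rule spectrum_on_eigenbasis[OF h])
  \<comment> \<open>All degrees are 4, so the Laplacian is \<open>4 I - A\<close> and shares the
    eigenfunctions \<open>h\<close>.\<close>
  have "eigenbasis (verts S) (lap_entry S) ?I (\<lambda>i. 4 - (case i of (i, j) \<Rightarrow> 2 * c i j)) h"
    by (rule eigenbasis_scalar_minus[OF h]) (simp add: lap_entry_def deg)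
  then have "laplacian_eigenvalues S = {#4 - (case i of (i, j) \<Rightarrow> 2 * c i j). i \<in># mset_set ?I#}"
    unfolding laplacian_eigenvalues_def by (rule spectrum_on_eigenbasis)
  then have evL: "laplacian_eigenvalues S = {#4 - 2 * c i j. (i, j) \<in># mset_set ?I#}"
    by (simp add: case_prod_unfold)
  have pos: "if i = m \<and> j = n \<and> even r1 \<and> even r2 then 4 - 2 * c i j = 0 else 4 - 2 * c i j > 0"
    if ij: "i \<in> {1..m}" "j \<in> {1..n}" for i j
  proof (cases "i = m \<and> j = n \<and> even r1 \<and> even r2")
    case True
    then show ?thesis
      using assms by (simp add: c_def cos_cycle_angle_eq_1)
  next
    case False
    \<comment> \<open>Outside the exceptional case at least one factor has a cosine below 1; the
      other is at most 1, so their sum stays below 2.\<close>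
    then have "cos (cycle_angle m r1 i) < 1 \<or> cos (cycle_angle n r2 j) < 1"
      using cos_cycle_angle_less_1[OF ij(1), of r1] cos_cycle_angle_less_1[OF ij(2), of r2] by blast
    then have "c i j < 2"
      using cos_le_one[of "cycle_angle m r1 i"] cos_le_one[of "cycle_angle n r2 j"]
      unfolding c_def by linarith
    then show ?thesis
      using False by auto
  qed
  have en: "energy S = 2 * (\<Sum>i=1..m. \<Sum>j=1..n. \<bar>c i j\<bar>)"
    unfolding energy_def ev
    by (simp add: image_mset.compositionality comp_def case_prod_unfold sum_unfold_sum_mset[symmetric]
        abs_mult sum.cartesian_product sum_distrib_left)
  \<comment> \<open>Subtracting the mean degree 4 from \<open>4 - 2 * c i j\<close> leaves
    \<open>- 2 * c i j\<close>, with the same absolute value as the adjacency eigenvalue.\<close>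
  have "laplacian_energy S = 2 * (\<Sum>i=1..m. \<Sum>j=1..n. \<bar>c i j\<bar>)"
    unfolding laplacian_energy_def evL mean
    by (simp add: image_mset.compositionality comp_def case_prod_unfold sum_unfold_sum_mset[symmetric]
        abs_mult sum.cartesian_product sum_distrib_left)
  with ev evL pos en show ?thesis
    unfolding Let_def S_def c_def cycle_angle_def by blast
qed

end
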